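(* Let $\mathcal{M}_1=(E_1,\rho_1)$ and $\mathcal{M}_2=(E_2,\rho_2)$ be weakly isomorphic $q$-matroids over $\mathbb{F}_q$, and let $\alpha:\mathcal{F}(\mathcal{M}_1)\to\mathcal{F}(\mathcal{M}_2)$ be a dimension-preserving lattice isomorphism. Then $\alpha$ extends to a bijection $\beta:\mathcal{L}(E_1)\to\mathcal{L}(E_2)$ such that $\dim\beta(V)=\dim V$ and $\rho_2(\beta(V))=\rho_1(V)$ for all $V\in\mathcal{L}(E_1)$, $\beta(F)=\alpha(F)$ for all $F\in\mathcal{F}(\mathcal{M}_1)$, and $\beta(\mathrm{cl}_1^{-1}(F))=\mathrm{cl}_2^{-1}(\alpha(F))$ for all $F\in\mathcal{F}(\mathcal{M}_1)$.
   Context: A $q$-matroid on a finite-dimensional $\mathbb{F}_q$-space $E$ is $(E,\rho)$ with $\rho$ from subspaces of $E$ to $\mathbb{N}_0$ satisfying $0\le\rho(V)\le\dim V$, monotonicity and submodularity $\rho(V+W)+\rho(V\cap W)\le\rho(V)+\rho(W)$. $\mathcal{L}(E)$ is the set of subspaces of $E$. In $\mathcal{M}_i$, the closure of a subspace $V$ is $\mathrm{cl}_i(V)=\{x\in E_i:\rho_i(V+\langle x\rangle)=\rho_i(V)\}$, a flat is a subspace $F$ with $\mathrm{cl}_i(F)=F$, $\mathcal{F}(\mathcal{M}_i)$ is the lattice of flats (ordered by inclusion, meet $\cap$, join $\mathrm{cl}_i(V_1+V_2)$), and $\mathrm{cl}_i^{-1}(F)=\{V\in\mathcal{L}(E_i):\mathrm{cl}_i(V)=F\}$.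 $\mathcal{M}_1,\mathcal{M}_2$ are weakly isomorphic if there exists a lattice isomorphism $\alpha:\mathcal{F}(\mathcal{M}_1)\to\mathcal{F}(\mathcal{M}_2)$ with $\dim\alpha(F)=\dim F$ for all flats $F$ (dimension-preserving). *)

theory Defs
  imports Complex_Main "HOL-Library.Set_Algebras"
begin

text \<open>
  The ground space is a finite-dimensional subspace \<open>E\<close> of an ambient vector space
  (whose underlying type may be larger), so that distinct q-matroids live on arbitrary spaces
  over the same finite field \<open>'k\<close>. Sums \<open>V + W\<close> of subspaces are elementwise
  sums. Rank functions, closures and maps between lattices of subspaces are total functions on sets of vectors; only their values on
  the relevant subspaces carry meaning.
\<close>

context vector_space
begin

definition subspaces_of :: "'b set \<Rightarrow> 'b set set" where
  "subspaces_of E = {V. subspace V \<and> V \<subseteq> E}"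

end

locale q_matroid = vector_space scale
  for scale :: "'k::{field,finite} \<Rightarrow> 'b::ab_group_add \<Rightarrow> 'b" +
  fixes E :: "'b set"
    and \<rho> :: "'b set \<Rightarrow> nat"
  assumes subspace_ground: "subspace E"
    and finite_dim_ground: "\<exists>B. finite B \<and> span B = E"
    and rank_le_dim: "V \<in> subspaces_of E \<Longrightarrow> \<rho> V \<le> dim V"
    and rank_mono: "\<lbrakk>V \<in> subspaces_of E; W \<in> subspaces_of E; V \<subseteq> W\<rbrakk> \<Longrightarrow> \<rho> V \<le> \<rho> W"
    and rank_submodular:
      "\<lbrakk>V \<in> subspaces_of E; W \<in> subspaces_of E\<rbrakk> \<Longrightarrow> \<rho> (V + W) + \<rho> (V \<inter> W) \<le> \<rho> V + \<rho> W"
begin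

definition cl :: "'b set \<Rightarrow> 'b set" where
  "cl V = {x \<in> E. \<rho> (V + span {x}) = \<rho> V}"

definition flats :: "'b set set" where
  "flats = {F \<in> subspaces_of E. cl F = F}"

definition flat_meet :: "'b set \<Rightarrow> 'b set \<Rightarrow> 'b set" where
  "flat_meet F G = F \<inter> G"

definition flat_join :: "'b set \<Rightarrow> 'b set \<Rightarrow> 'b set" where
  "flat_join F G = cl (F + G)"

definition cl_fibre :: "'b set \<Rightarrow> 'b set set" where
  "cl_fibre F = {V \<in> subspaces_of E. cl V = F}"

end

locale q_matroid_pair =
  M1: q_matroid scale1 E1 \<rho>1 + M2: q_matroid scale2 E2 \<rho>2
  for scale1 :: "'k::{field,finite} \<Rightarrow> 'b::ab_group_add \<Rightarrow> 'b"
    and E1 :: "'b set"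
    and \<rho>1 :: "'b set \<Rightarrow> nat"
    and scale2 :: "'k \<Rightarrow> 'c::ab_group_add \<Rightarrow> 'c"
    and E2 :: "'c set"
    and \<rho>2 :: "'c set \<Rightarrow> nat"
begin

definition flat_lattice_iso :: "('b set \<Rightarrow> 'c set) \<Rightarrow> bool" where
  "flat_lattice_iso \<alpha> \<longleftrightarrow>
     bij_betw \<alpha> M1.flats M2.flats \<and>
     (\<forall>F\<in>M1.flats. \<forall>G\<in>M1.flats.
        \<alpha> (M1.flat_meet F G) = M2.flat_meet (\<alpha> F) (\<alpha> G) \<and>
        \<alpha> (M1.flat_join F G) = M2.flat_join (\<alpha> F) (\<alpha> G))"

definition dim_preserving :: "('b set \<Rightarrow> 'c set) \<Rightarrow> bool" where
  "dim_preserving \<alpha> \<longleftrightarrow> (\<forall>F\<in>M1.flats. M2.dim (\<alpha> F) = M1.dim F)"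

definition weakly_isomorphic :: bool where
  "weakly_isomorphic \<longleftrightarrow> (\<exists>\<alpha>. flat_lattice_iso \<alpha> \<and> dim_preserving \<alpha>)"

end

end

theory Submission
  imports Defs "HOL-Library.Disjoint_Sets"
begin

text \<open>
  A subspace of a flat \<open>F\<close> lies in the closure fibre of exactly one flat \<open>G \<subseteq> F\<close>, so the number
  of \<open>d\<close>-dimensional subspaces of \<open>F\<close>, which depends only on \<open>dim F\<close> and \<open>q\<close>, is the sum over the
  flats \<open>G \<subseteq> F\<close> of the number of \<open>d\<close>-dimensional members of the fibre of \<open>G\<close>. Induction over the
  lattice of flats shows that the fibres of \<open>F\<close> and of \<open>\<alpha> F\<close> contain equally many subspaces of each
  dimension, and \<open>\<beta>\<close> is glued from arbitrary bijections between these pieces. It extends \<open>\<alpha>\<close> because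
  \<open>F\<close> is the only member of its fibre of dimension \<open>dim F\<close>, and it preserves rank because the rank of
  a flat is the smallest dimension occurring in its fibre.
\<close>

section \<open>Finite subspaces\<close>

context vector_space
begin

text \<open>Each vector of \<open>span (insert a B)\<close> is a scalar multiple of \<open>a\<close>
  plus a vector of \<open>span B\<close>, and there are finitely many scalars. Over a finite field
  the ground space is thus a finite set, which makes counting its subspaces meaningful.\<close>

lemma finite_span:
  assumes "finite (UNIV :: 'a set)" "finite B"
  shows "finite (span B)"
  using assms(2)
proof induction
  case (insert a B)
  have "span (insert a B) \<subseteq> (\<lambda>(k, y). scale k a + y) ` (UNIV \<times> span B)"
  proof
    fix x assume "x \<in> span (insert a B)"
    then obtain k where "x - scale k a \<in> span B"
      by (auto simp: span_insert)
    then show "x \<in> (\<lambda>(k, y). scale k a + y) ` (UNIV \<times> span B)"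
      by (intro image_eqI[of _ _ "(k, x - scale k a)"]) auto
  qed
  with insert assms(1) show ?case
    by (meson finite_SigmaI finite_imageI finite_subset)
qed simp

lemma subspace_plus_eq_span:
  assumes "subspace V" "subspace W"
  shows "V + W = span (V \<union> W)"
  unfolding span_Un using assms by (auto simp: set_plus_def span_eq_iff[THEN iffD2])

lemma subspace_eq_of_dim_eq:
  assumes "subspace V" "subspace W" "V \<subseteq> W" "finite W" "dim V = dim W"
  shows "V = W"
proof -
  obtain B where B: "B \<subseteq> V" "independent B" "V \<subseteq> span B" "card B = dim V"
    by (rule basis_exists)
  obtain C where C: "B \<subseteq> C" "C \<subseteq> W" "independent C" "W \<subseteq> span C"
    using maximal_independent_subset_extend[of B W] B assms(3) by blast
  have "card C = dim W"
    using C by (simp add: basis_card_eq_dim)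
  then have "B = C"
    using B C assms by (metis card_subset_eq finite_subset)
  then show ?thesis
    using B C assms by (metis span_subspace subset_antisym)
qed

end

section \<open>Counting subspaces of a given dimension\<close>

context vector_space_pair
begin

text \<open>Spaces of equal finite dimension are linearly isomorphic, and taking images under an
  isomorphism is a dimension-preserving bijection between their subspaces. No explicit formula for
  the count is required.\<close>

lemma card_subspaces_of_dim:
  assumes "vs1.subspace S" "vs2.subspace T" "finite S" "finite T" "vs1.dim S = vs2.dim T"
  shows "card {V \<in> vs1.subspaces_of S. vs1.dim V = d} = card {W \<in> vs2.subspaces_of T. vs2.dim W = d}"
proof -
  obtain B where B: "B \<subseteq> S" "vs1.independent B" "S \<subseteq> vs1.span B" "card B = vs1.dim S"
    by (rule vs1.basis_exists)
  obtain C where C: "C \<subseteq> T" "vs2.independent C" "T \<subseteq> vs2.span C" "card C = vs2.dim T"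
    by (rule vs2.basis_exists)
  obtain f where f: "Vector_Spaces.linear s1 s2 f" "f ` S = T" "inj_on f S"
    using finite_basis_to_basis_subspace_isomorphism[OF assms(1,2,5) _ B _ C] B C assms(3,4)
    by (meson finite_subset)
  interpret f: Vector_Spaces.linear s1 s2 f by (rule f(1))
  have dim_f: "vs2.dim (f ` V) = vs1.dim V" if V: "vs1.subspace V" "V \<subseteq> S" for V
  proof -
    obtain D where D: "D \<subseteq> V" "vs1.independent D" "V \<subseteq> vs1.span D" "card D = vs1.dim V"
      by (rule vs1.basis_exists)
    have span_D: "vs1.span D = V"
      using D V by (simp add: vs1.span_subspace)
    have inj: "inj_on f V"
      using f(3) V inj_on_subset by blast
    have "vs2.independent (f ` D)"
      using f.dependent_inj_imageD[of D] D(2) inj span_D by blast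
    moreover have "vs2.span (f ` D) = f ` V"
      by (simp add: f.span_image span_D)
    ultimately have "vs2.dim (f ` V) = card (f ` D)"
      by (metis vs2.dim_span_eq_card_independent)
    also have "\<dots> = vs1.dim V"
      using D inj by (metis card_image inj_on_subset)
    finally show ?thesis .
  qed
  have "bij_betw ((`) f) {V \<in> vs1.subspaces_of S. vs1.dim V = d} {W \<in> vs2.subspaces_of T. vs2.dim W = d}"
  proof (rule bij_betw_imageI)
    show "inj_on ((`) f) {V \<in> vs1.subspaces_of S. vs1.dim V = d}"
      using f(3) by (auto simp: inj_on_def vs1.subspaces_of_def inj_on_image_eq_iff[OF f(3)])
    show "(`) f ` {V \<in> vs1.subspaces_of S. vs1.dim V = d} = {W \<in> vs2.subspaces_of T. vs2.dim W = d}"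
    proof (intro equalityI subsetI)
      fix W assume "W \<in> (`) f ` {V \<in> vs1.subspaces_of S. vs1.dim V = d}"
      then show "W \<in> {W \<in> vs2.subspaces_of T. vs2.dim W = d}"
        using f(2) by (auto simp: vs1.subspaces_of_def vs2.subspaces_of_def dim_f f.subspace_image)
    next
      fix W assume W: "W \<in> {W \<in> vs2.subspaces_of T. vs2.dim W = d}"
      \<comment> \<open>\<open>f\<close> is linear on the whole ambient space but known to be
        injective only on \<open>S\<close>, so the preimage is cut down to \<open>S\<close>.\<close>
      define V where "V = S \<inter> f -` W"
      have V: "vs1.subspace V" "V \<subseteq> S"
        using W assms(1) by (auto simp: V_def vs2.subspaces_of_def vs1.subspace_inter f.subspace_vimage)
      have "W = f ` V"
        using W f(2) by (auto simp: V_def vs2.subspaces_of_def)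
      then show "W \<in> (`) f ` {V \<in> vs1.subspaces_of S. vs1.dim V = d}"
        using V W dim_f[OF V] by (auto simp: vs1.subspaces_of_def)
    qed
  qed
  then show ?thesis
    by (rule bij_betw_same_card)
qed

end

section \<open>The closure operator and flats of a q-matroid\<close>

context q_matroid
begin

lemma finite_ground: "finite E"
  using finite_dim_ground finite_span by auto

lemma finite_subspaces_of: "finite (subspaces_of E)"
  using finite_ground by (auto simp: subspaces_of_def intro: finite_subset[of _ "Pow E"])

lemma span_in_subspaces_of: "A \<subseteq> E \<Longrightarrow> span A \<in> subspaces_of E"
  by (simp add: subspaces_of_def span_minimal subspace_ground)

lemma rank_span_mono: "A \<subseteq> span B \<Longrightarrow> B \<subseteq> E \<Longrightarrow> \<rho> (span A) \<le> \<rho> (span B)"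
  using span_in_subspaces_of[of B] span_minimal[of A "span B"]
  by (intro rank_mono) (auto simp: subspaces_of_def)

lemma mem_cl_iff:
  assumes "V \<in> subspaces_of E"
  shows "x \<in> cl V \<longleftrightarrow> x \<in> E \<and> \<rho> (span (insert x V)) = \<rho> V"
proof -
  have "V + span {x} = span (insert x V)"
    using assms subspace_plus_eq_span[of V "span {x}"]
    by (simp add: subspaces_of_def span_Un span_span flip: insert_is_Un)
      (metis insert_is_Un span_Un sup_commute)
  then show ?thesis
    by (simp add: cl_def)
qed

lemma cl_subset_ground: "cl V \<subseteq> E"
  by (auto simp: cl_def)

lemma subset_cl:
  assumes "V \<in> subspaces_of E"
  shows "V \<subseteq> cl V"
  using assms by (auto simp: mem_cl_iff subspaces_of_def insert_absorb span_eq_iff[THEN iffD2])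

text \<open>Diminishing returns: a vector that does not raise the rank of \<open>U\<close> does not
  raise that of any larger \<open>W\<close>. This is submodularity for \<open>W\<close> and
  \<open>span (insert x U)\<close>, whose sum is \<open>span (insert x W)\<close> and whose
  intersection contains \<open>U\<close>.\<close>

lemma rank_span_insert_eq:
  assumes "U \<in> subspaces_of E" "W \<in> subspaces_of E" "U \<subseteq> W" "x \<in> cl U"
  shows "\<rho> (span (insert x W)) = \<rho> W"
proof -
  let ?X = "span (insert x U)"
  have x: "x \<in> E" "\<rho> ?X = \<rho> U"
    using assms by (auto simp: mem_cl_iff)
  have X: "?X \<in> subspaces_of E"
    using assms x by (intro span_in_subspaces_of) (auto simp: subspaces_of_def)
  have sub: "subspace W" "subspace U" "W \<subseteq> E"
    using assms by (auto simp: subspaces_of_def)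
  have "W + ?X = span (W \<union> ?X)"
    using sub by (simp add: subspace_plus_eq_span)
  also have "\<dots> = span (insert x W)"
  proof (rule span_unique)
    show "W \<union> ?X \<subseteq> span (insert x W)"
      using assms(3) span_mono[of "insert x U" "insert x W"] span_superset[of "insert x W"] by auto
    fix Y assume "W \<union> ?X \<subseteq> Y" "subspace Y"
    then show "span (insert x W) \<subseteq> Y"
      using span_base[of x "insert x U"] by (intro span_minimal) auto
  qed simp
  finally have eq: "W + ?X = span (insert x W)" .
  have int: "W \<inter> ?X \<in> subspaces_of E"
    using X sub by (auto simp: subspaces_of_def subspace_inter)
  have "\<rho> U \<le> \<rho> (W \<inter> ?X)"
    using assms int span_superset[of "insert x U"] by (intro rank_mono) auto
  moreover have "\<rho> (span (insert x W)) + \<rho> (W \<inter> ?X) \<le> \<rho> W + \<rho> ?X"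
    using rank_submodular[OF assms(2) X] eq by simp
  moreover have "\<rho> W \<le> \<rho> (span (insert x W))"
    using assms x sub span_superset[of "insert x W"]
    by (intro rank_mono) (auto intro!: span_in_subspaces_of)
  ultimately show ?thesis
    using x by linarith
qed

text \<open>The vectors of \<open>A\<close> are added one at a time; by diminishing returns none of
  them raises the rank of the span reached so far.\<close>

lemma rank_span_Un_eq:
  assumes "V \<in> subspaces_of E" "finite A" "A \<subseteq> cl V"
  shows "\<rho> (span (V \<union> A)) = \<rho> V"
  using assms(2,3)
proof induction
  case empty
  then show ?case
    using assms by (simp add: subspaces_of_def span_eq_iff[THEN iffD2])
next
  case (insert a A)
  let ?W = "span (V \<union> A)"
  have W: "?W \<in> subspaces_of E" "V \<subseteq> ?W"
    using assms insert.prems cl_subset_ground[of V] span_superset[of "V \<union> A"]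
      span_in_subspaces_of[of "V \<union> A"] by (auto simp: subspaces_of_def)
  have "span (insert a ?W) = span (V \<union> insert a A)"
    by (simp add: span_insert span_span)
  then show ?case
    using rank_span_insert_eq[OF assms(1) W, of a] insert by simp
qed

text \<open>That \<open>cl V\<close> is a subspace is not evident from its definition. It is
  identified with \<open>?W\<close>, the span of \<open>V\<close> and \<open>cl V\<close>, which has
  the same rank as \<open>V\<close>.\<close>

lemma
  assumes "V \<in> subspaces_of E"
  shows rank_cl: "\<rho> (cl V) = \<rho> V"
    and cl_in_flats: "cl V \<in> flats"
proof -
  let ?W = "span (V \<union> cl V)"
  have V: "V \<subseteq> E" "subspace V"
    using assms by (auto simp: subspaces_of_def)
  have W: "?W \<in> subspaces_of E"
    using V cl_subset_ground by (intro span_in_subspaces_of) auto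
  have rank_W: "\<rho> ?W = \<rho> V"
    using assms finite_ground cl_subset_ground by (intro rank_span_Un_eq) (auto intro: finite_subset)
  \<comment> \<open>The rank of \<open>span (insert x V)\<close> lies between those of
    \<open>V\<close> and \<open>span (insert x ?W)\<close>, which agree. Used with \<open>x\<close>
    in \<open>?W\<close> this gives \<open>?W \<subseteq> cl V\<close>; used with \<open>x\<close>
    in \<open>cl (cl V)\<close> it gives idempotence.\<close>
  have sandwich: "x \<in> cl V" if "x \<in> E" "\<rho> (span (insert x ?W)) = \<rho> V" for x
  proof -
    have "\<rho> (span (insert x V)) \<le> \<rho> (span (insert x ?W))"
      using that V W span_superset[of "insert x ?W"] span_superset[of "V \<union> cl V"]
      by (intro rank_span_mono) (auto simp: subspaces_of_def)
    moreover have "\<rho> V \<le> \<rho> (span (insert x V))"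
      using that V assms span_superset[of "insert x V"]
      by (intro rank_mono span_in_subspaces_of) auto
    ultimately show ?thesis
      using that assms by (simp add: mem_cl_iff)
  qed
  have "?W \<subseteq> cl V"
  proof
    fix x assume "x \<in> ?W"
    then show "x \<in> cl V"
      using W rank_W by (intro sandwich) (auto simp: subspaces_of_def insert_absorb span_eq_iff[THEN iffD2])
  qed
  then have cl_eq: "cl V = ?W"
    using span_superset[of "V \<union> cl V"] by auto
  then show "\<rho> (cl V) = \<rho> V"
    using rank_W by simp
  have "cl (cl V) \<subseteq> cl V"
  proof
    fix x assume "x \<in> cl (cl V)"
    then show "x \<in> cl V"
      using W rank_W cl_eq by (intro sandwich) (auto simp: mem_cl_iff)
  qed
  then show "cl V \<in> flats"
    using W cl_eq subset_cl[of "cl V"] by (auto simp: flats_def)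
qed

lemma flats_subspace: "F \<in> flats \<Longrightarrow> F \<in> subspaces_of E"
  and cl_flat: "F \<in> flats \<Longrightarrow> cl F = F"
  by (auto simp: flats_def)

lemma finite_flats: "finite flats"
  using finite_subspaces_of by (auto simp: flats_def)

text \<open>A vector that is rank-neutral over \<open>V\<close> stays so over \<open>F\<close>, and
  \<open>F\<close> is closed. Hence \<open>cl V\<close> is the least flat containing
  \<open>V\<close>.\<close>

lemma cl_subset_flat_iff:
  assumes "V \<in> subspaces_of E" "F \<in> flats"
  shows "cl V \<subseteq> F \<longleftrightarrow> V \<subseteq> F"
proof
  assume "V \<subseteq> F"
  show "cl V \<subseteq> F"
  proof
    fix x assume "x \<in> cl V"
    then have "x \<in> cl F"
      using rank_span_insert_eq[of V F x] assms \<open>V \<subseteq> F\<close> flats_subspace cl_subset_ground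
      by (auto simp: mem_cl_iff)
    then show "x \<in> F"
      using assms cl_flat by simp
  qed
qed (use assms subset_cl in auto)

section \<open>Closure fibres and their dimensions\<close>

lemma flat_in_cl_fibre: "F \<in> flats \<Longrightarrow> F \<in> cl_fibre F"
  by (simp add: cl_fibre_def flats_def)

lemma cl_fibre_subset: "V \<in> cl_fibre F \<Longrightarrow> V \<subseteq> F"
  using subset_cl by (auto simp: cl_fibre_def)

lemma cl_fibre_eq_flat:
  assumes "F \<in> flats" "V \<in> cl_fibre F" "dim V = dim F"
  shows "V = F"
proof -
  have F: "subspace F" "finite F"
    using flats_subspace[OF assms(1)] finite_ground by (auto simp: subspaces_of_def finite_subset)
  have V: "subspace V"
    using assms(2) by (simp add: cl_fibre_def subspaces_of_def)
  show ?thesis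
    using V F(1) cl_fibre_subset[OF assms(2)] F(2) assms(3) by (rule subspace_eq_of_dim_eq)
qed

lemma rank_le_dim_cl_fibre: "V \<in> cl_fibre F \<Longrightarrow> \<rho> F \<le> dim V"
  using rank_cl[of V] rank_le_dim[of V] by (auto simp: cl_fibre_def)

text \<open>A maximal independent subspace \<open>I\<close> of \<open>F\<close>, independent meaning
  that dimension equals rank, has closure \<open>F\<close>. Together with
  \<open>rank_le_dim_cl_fibre\<close> this makes \<rho> \<open>F\<close> the least dimension in the
  fibre of \<open>F\<close>.\<close>

lemma ex_cl_fibre_dim_eq_rank:
  assumes "F \<in> flats"
  obtains I where "I \<in> cl_fibre F" "dim I = \<rho> F"
proof -
  let ?P = "\<lambda>I. I \<in> subspaces_of E \<and> I \<subseteq> F \<and> dim I = \<rho> I"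
  have F: "F \<in> subspaces_of E" "subspace F" "F \<subseteq> E"
    using assms flats_subspace by (auto simp: subspaces_of_def)
  have "dim {0} = 0"
    using dim_unique[of "{}" "{0}" 0] independent_empty by simp
  then have "?P {0}"
    using F rank_le_dim[of "{0}"] subspace_0[OF F(2)] by (auto simp: subspaces_of_def)
  moreover have "finite {I. ?P I}"
    using finite_subspaces_of by (auto intro: finite_subset[of _ "subspaces_of E"])
  ultimately have "\<exists>I\<in>{I. ?P I}. \<forall>J\<in>{I. ?P I}. I \<subseteq> J \<longrightarrow> I = J"
    by (intro finite_has_maximal) blast+
  then obtain I where "I \<in> {I. ?P I}" and maximal: "\<forall>J\<in>{I. ?P I}. I \<subseteq> J \<longrightarrow> I = J"
    by (rule bexE)
  then have I: "?P I"
    by simp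
  have "x \<in> cl I" if "x \<in> F" for x
  proof (rule ccontr)
    let ?J = "span (insert x I)"
    assume "x \<notin> cl I"
    have J: "?J \<in> subspaces_of E" "I \<subseteq> ?J" "?J \<subseteq> F"
      using that I F span_superset[of "insert x I"] span_in_subspaces_of[of "insert x I"]
        span_minimal[of "insert x I" F] by auto
    obtain B where B: "B \<subseteq> I" "independent B" "I \<subseteq> span B" "card B = dim I"
      by (rule basis_exists)
    have "finite B"
      using B I finite_ground by (meson F(3) finite_subset)
    \<comment> \<open>Adding \<open>x\<close> raises the dimension by at most one, while outside the
      closure it raises the rank by at least one. So \<open>?J\<close> is again independent, against
      the maximality of \<open>I\<close>.\<close>
    have "insert x I \<subseteq> span (insert x B)"
      using B span_mono[of B "insert x B"] span_base by auto
    then have "?J \<subseteq> span (insert x B)"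
      by (intro span_minimal) auto
    then have "dim ?J \<le> card (insert x B)"
      using \<open>finite B\<close> by (intro dim_le_card) auto
    also have "\<dots> \<le> Suc (\<rho> I)"
      using B I \<open>finite B\<close> by (simp add: card_insert_if)
    finally have "dim ?J \<le> Suc (\<rho> I)" .
    moreover have "\<rho> I \<noteq> \<rho> ?J"
      using \<open>x \<notin> cl I\<close> that I F by (auto simp: mem_cl_iff)
    moreover have "\<rho> I \<le> \<rho> ?J" "\<rho> ?J \<le> dim ?J"
      using J I rank_le_dim[of ?J] by (auto intro: rank_mono)
    ultimately have "?P ?J"
      using J by auto
    then have "I = ?J"
      using J maximal by simp
    then show False
      using \<open>\<rho> I \<noteq> \<rho> ?J\<close> by simp
  qed
  then have "cl I = F"
    using I assms cl_subset_flat_iff[of I F] by auto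
  then show ?thesis
    using that[of I] I rank_cl[of I] by (auto simp: cl_fibre_def)
qed

text \<open>Rank is constant on a fibre but dimension is not, so a bijection preserving both has to
  be built on these smaller pieces.\<close>

definition cl_fibre_dim :: "'b set \<Rightarrow> nat \<Rightarrow> 'b set set" where
  "cl_fibre_dim F d = {V \<in> cl_fibre F. dim V = d}"

lemma finite_cl_fibre_dim: "finite (cl_fibre_dim F d)"
  using finite_subspaces_of by (auto simp: cl_fibre_dim_def cl_fibre_def)

text \<open>The subspaces of \<open>F\<close> are partitioned by their closures, which are exactly
  flats below \<open>F\<close>. The term of \<open>F\<close> itself is split off so that an
  induction can solve for it.\<close>

lemma card_subspaces_of_flat:
  assumes "F \<in> flats"
  shows "card {V \<in> subspaces_of F. dim V = d} =
    card (cl_fibre_dim F d) + (\<Sum>G \<in> {G \<in> flats. G \<subset> F}. card (cl_fibre_dim G d))"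
proof -
  have "F \<subseteq> E"
    using assms flats_subspace by (auto simp: subspaces_of_def)
  then have "{V \<in> subspaces_of F. dim V = d} = (\<Union>G \<in> {G \<in> flats. G \<subseteq> F}. cl_fibre_dim G d)"
    using assms subset_cl cl_in_flats cl_subset_flat_iff
    by (auto simp: cl_fibre_dim_def cl_fibre_def subspaces_of_def)
  also have "card \<dots> = (\<Sum>G \<in> {G \<in> flats. G \<subseteq> F}. card (cl_fibre_dim G d))"
    using finite_flats finite_cl_fibre_dim
    by (intro card_UN_disjoint) (auto simp: cl_fibre_dim_def cl_fibre_def)
  also have "{G \<in> flats. G \<subseteq> F} = insert F {G \<in> flats. G \<subset> F}"
    using assms by auto
  also have "(\<Sum>G \<in> \<dots>. card (cl_fibre_dim G d)) =
    card (cl_fibre_dim F d) + (\<Sum>G \<in> {G \<in> flats. G \<subset> F}. card (cl_fibre_dim G d))"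
    using finite_flats by (subst sum.insert) auto
  finally show ?thesis .
qed

end

section \<open>Transfer of fibre sizes and ranks along \<alpha>\<close>

context q_matroid_pair
begin

text \<open>The order is recovered from meets: \<open>F \<subseteq> G\<close> means
  \<open>F \<inter> G = F\<close>. Since \<alpha> is injective only on flats,
  \<open>F \<inter> G\<close> must first be seen to be a flat; its closure lies in both
  \<open>F\<close> and \<open>G\<close>.\<close>

lemma flat_lattice_iso_psubset_iff:
  assumes "flat_lattice_iso \<alpha>" "F \<in> M1.flats" "G \<in> M1.flats"
  shows "\<alpha> F \<subset> \<alpha> G \<longleftrightarrow> F \<subset> G"
proof -
  have inj: "inj_on \<alpha> M1.flats" and meet: "\<alpha> (F \<inter> G) = \<alpha> F \<inter> \<alpha> G"
    using assms by (auto simp: flat_lattice_iso_def bij_betw_def M1.flat_meet_def M2.flat_meet_def)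
  have "F \<inter> G \<in> M1.flats"
  proof -
    have sub: "F \<inter> G \<in> M1.subspaces_of E1"
      using assms M1.flats_subspace[of F] M1.flats_subspace[of G]
      by (auto simp: M1.subspaces_of_def M1.subspace_inter)
    then have "M1.cl (F \<inter> G) = F \<inter> G"
      using M1.cl_subset_flat_iff[OF sub] M1.subset_cl[OF sub] assms by blast
    with sub show ?thesis
      by (simp add: M1.flats_def)
  qed
  then have "F \<subseteq> G \<longleftrightarrow> \<alpha> F \<subseteq> \<alpha> G"
    using meet inj assms by (metis inf.absorb_iff1 inj_on_eq_iff)
  then show ?thesis
    using inj assms by (metis inj_on_eq_iff psubset_eq)
qed

text \<open>Induction on \<open>F\<close> under strict inclusion, with \<open>d\<close> fixed.
  \<open>F\<close> and its image have equally many \<open>d\<close>-dimensional subspaces, and the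
  flats strictly below them contribute equally by the induction hypothesis, so the remaining terms
  agree.\<close>

lemma card_cl_fibre_dim_eq:
  assumes iso: "flat_lattice_iso \<alpha>" and dim: "dim_preserving \<alpha>" and "F \<in> M1.flats"
  shows "card (M1.cl_fibre_dim F d) = card (M2.cl_fibre_dim (\<alpha> F) d)"
proof -
  have bij: "bij_betw \<alpha> M1.flats M2.flats"
    using iso by (simp add: flat_lattice_iso_def)
  have fin1: "finite G" and fin2: "finite (\<alpha> G)" if "G \<in> M1.flats" for G
    using that bij M1.flats_subspace M1.finite_ground M2.flats_subspace[of "\<alpha> G"] M2.finite_ground
    by (auto simp: M1.subspaces_of_def M2.subspaces_of_def bij_betw_apply intro: finite_subset)
  have "finite F"
    using fin1 assms(3) by simp
  then show ?thesis
    using assms(3)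
  proof (induction F rule: finite_psubset_induct)
    case (psubset F)
    interpret vector_space_pair scale1 scale2 ..
    have aF: "\<alpha> F \<in> M2.flats"
      using bij psubset by (simp add: bij_betw_apply)
    have "card {V \<in> M1.subspaces_of F. M1.dim V = d} =
        card {W \<in> M2.subspaces_of (\<alpha> F). M2.dim W = d}"
      using psubset aF dim M1.flats_subspace[of F] M2.flats_subspace[of "\<alpha> F"] fin2
      by (intro card_subspaces_of_dim)
        (auto simp: M1.subspaces_of_def M2.subspaces_of_def dim_preserving_def)
    moreover have "(\<Sum>G \<in> {G \<in> M1.flats. G \<subset> F}. card (M1.cl_fibre_dim G d)) =
        (\<Sum>H \<in> {H \<in> M2.flats. H \<subset> \<alpha> F}. card (M2.cl_fibre_dim H d))"
    proof -
      \<comment> \<open>Surjectivity writes every \<open>H\<close> as an image, and \<alpha>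
        reflects strict inclusion; so \<alpha> restricts to a bijection between the flats strictly
        below \<open>F\<close> and those strictly below its image, which reindexes the sum.\<close>
      have "{H \<in> M2.flats. H \<subset> \<alpha> F} = \<alpha> ` {G \<in> M1.flats. \<alpha> G \<subset> \<alpha> F}"
        unfolding bij_betw_imp_surj_on[OF bij, symmetric] by blast
      also have "{G \<in> M1.flats. \<alpha> G \<subset> \<alpha> F} = {G \<in> M1.flats. G \<subset> F}"
        using flat_lattice_iso_psubset_iff[OF iso _ psubset.prems] by (intro Collect_cong) metis
      finally have "bij_betw \<alpha> {G \<in> M1.flats. G \<subset> F} {H \<in> M2.flats. H \<subset> \<alpha> F}"
        by (intro bij_betw_subset[OF bij]) auto
      then have "(\<Sum>G \<in> {G \<in> M1.flats. G \<subset> F}. card (M2.cl_fibre_dim (\<alpha> G) d)) =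
          (\<Sum>H \<in> {H \<in> M2.flats. H \<subset> \<alpha> F}. card (M2.cl_fibre_dim H d))"
        by (rule sum.reindex_bij_betw)
      then show ?thesis
        using psubset.IH by simp
    qed
    ultimately show ?case
      using M1.card_subspaces_of_flat[OF psubset.prems, of d] M2.card_subspaces_of_flat[OF aF, of d]
      by linarith
  qed
qed

text \<open>The rank of a flat is the least \<open>d\<close> for which its piece of dimension
  \<open>d\<close> is nonempty, hence is determined by the cardinalities.\<close>

lemma rank_flat_eq:
  assumes "F \<in> M1.flats" "G \<in> M2.flats"
    and card_eq: "\<And>d. card (M1.cl_fibre_dim F d) = card (M2.cl_fibre_dim G d)"
  shows "\<rho>2 G = \<rho>1 F"
proof (rule antisym)
  obtain I where "I \<in> M1.cl_fibre_dim F (\<rho>1 F)"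
    using M1.ex_cl_fibre_dim_eq_rank[OF assms(1)] by (auto simp: M1.cl_fibre_dim_def)
  \<comment> \<open>Finiteness matters here, because \<open>card\<close> is also zero on infinite
    sets.\<close>
  then have "M2.cl_fibre_dim G (\<rho>1 F) \<noteq> {}"
    using card_eq[of "\<rho>1 F"] M1.finite_cl_fibre_dim[of F "\<rho>1 F"] by (auto simp: card_eq_0_iff)
  then show "\<rho>2 G \<le> \<rho>1 F"
    by (auto simp: M2.cl_fibre_dim_def dest: M2.rank_le_dim_cl_fibre)
next
  obtain I where "I \<in> M2.cl_fibre_dim G (\<rho>2 G)"
    using M2.ex_cl_fibre_dim_eq_rank[OF assms(2)] by (auto simp: M2.cl_fibre_dim_def)
  then have "M1.cl_fibre_dim F (\<rho>2 G) \<noteq> {}"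
    using card_eq[of "\<rho>2 G"] M2.finite_cl_fibre_dim[of G "\<rho>2 G"] by (auto simp: card_eq_0_iff)
  then show "\<rho>1 F \<le> \<rho>2 G"
    by (auto simp: M1.cl_fibre_dim_def dest: M1.rank_le_dim_cl_fibre)
qed

end

section \<open>Gluing the bijections of the pieces\<close>

theorem theorem6p8:
  fixes scale1 :: "'k::{field,finite} \<Rightarrow> 'b::ab_group_add \<Rightarrow> 'b"
    and E1 :: "'b set"
    and \<rho>1 :: "'b set \<Rightarrow> nat"
    and scale2 :: "'k \<Rightarrow> 'c::ab_group_add \<Rightarrow> 'c"
    and E2 :: "'c set"
    and \<rho>2 :: "'c set \<Rightarrow> nat"
    and \<alpha> :: "'b set \<Rightarrow> 'c set"
  assumes "q_matroid scale1 E1 \<rho>1"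
    and "q_matroid scale2 E2 \<rho>2"
    and "q_matroid_pair.weakly_isomorphic scale1 E1 \<rho>1 scale2 E2 \<rho>2"
    and "q_matroid_pair.flat_lattice_iso scale1 E1 \<rho>1 scale2 E2 \<rho>2 \<alpha>"
    and "q_matroid_pair.dim_preserving scale1 E1 \<rho>1 scale2 \<alpha>"
  shows "\<exists>\<beta> :: 'b set \<Rightarrow> 'c set.
    bij_betw \<beta> (vector_space.subspaces_of scale1 E1) (vector_space.subspaces_of scale2 E2) \<and>
    (\<forall>V \<in> vector_space.subspaces_of scale1 E1.
       vector_space.dim scale2 (\<beta> V) = vector_space.dim scale1 V \<and> \<rho>2 (\<beta> V) = \<rho>1 V) \<and>
    (\<forall>F \<in> q_matroid.flats scale1 E1 \<rho>1. \<beta> F = \<alpha> F) \<and>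
    (\<forall>F \<in> q_matroid.flats scale1 E1 \<rho>1.
       \<beta> ` q_matroid.cl_fibre scale1 E1 \<rho>1 F = q_matroid.cl_fibre scale2 E2 \<rho>2 (\<alpha> F))"
proof -
  interpret q_matroid_pair scale1 E1 \<rho>1 scale2 E2 \<rho>2
    using assms(1,2) by (rule q_matroid_pair.intro)
  note iso = assms(4) and dim = assms(5)
  have bij: "bij_betw \<alpha> M1.flats M2.flats"
    using iso by (simp add: flat_lattice_iso_def)
  note card_eq = card_cl_fibre_dim_eq[OF iso dim]
  have "\<exists>b. bij_betw b (M1.cl_fibre_dim F d) (M2.cl_fibre_dim (\<alpha> F) d)" if "F \<in> M1.flats" for F d
    using that card_eq M1.finite_cl_fibre_dim M2.finite_cl_fibre_dim by (intro finite_same_card_bij)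
  then obtain b where b: "\<And>F d. F \<in> M1.flats \<Longrightarrow>
      bij_betw (b F d) (M1.cl_fibre_dim F d) (M2.cl_fibre_dim (\<alpha> F) d)"
    by metis
  \<comment> \<open>Closure and dimension of \<open>V\<close> select the one piece containing it, so
    \<beta> coincides with \<open>b F d\<close> on the piece of \<open>F\<close> and
    \<open>d\<close>.\<close>
  define \<beta> where "\<beta> V = b (M1.cl V) (M1.dim V) V" for V
  have piece: "bij_betw \<beta> (M1.cl_fibre_dim F d) (M2.cl_fibre_dim (\<alpha> F) d)" if "F \<in> M1.flats" for F d
    using b[OF that, of d]
    by (rule iffD1[OF bij_betw_cong, rotated])
      (auto simp: \<beta>_def M1.cl_fibre_dim_def M1.cl_fibre_def)
  have \<beta>_fibre: "\<beta> V \<in> M2.cl_fibre_dim (\<alpha> F) (M1.dim V)"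
    if "F \<in> M1.flats" "V \<in> M1.cl_fibre F" for F V
    using bij_betw_apply[OF piece[OF that(1)], of V "M1.dim V"] that
    by (auto simp: M1.cl_fibre_dim_def)
  have fibre: "V \<in> M1.cl_fibre (M1.cl V)" if "V \<in> M1.subspaces_of E1" for V
    using that by (simp add: M1.cl_fibre_def)

  have "bij_betw \<beta> (\<Union>(F, d) \<in> M1.flats \<times> UNIV. M1.cl_fibre_dim F d)
      (\<Union>(F, d) \<in> M1.flats \<times> UNIV. M2.cl_fibre_dim (\<alpha> F) d)"
  proof (rule bij_betw_UNION_disjoint)
    \<comment> \<open>A subspace has one closure and one dimension, and distinct \<open>F\<close>
      have distinct images by injectivity of \<alpha>.\<close>
    show "disjoint_family_on (\<lambda>(F, d). M2.cl_fibre_dim (\<alpha> F) d) (M1.flats \<times> UNIV)"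
      using bij by (auto simp: disjoint_family_on_def M2.cl_fibre_dim_def M2.cl_fibre_def
          bij_betw_def inj_on_eq_iff)
  qed (use piece in auto)
  moreover have "(\<Union>(F, d) \<in> M1.flats \<times> UNIV. M1.cl_fibre_dim F d) = M1.subspaces_of E1"
    using M1.cl_in_flats by (auto simp: M1.cl_fibre_dim_def M1.cl_fibre_def)
  moreover have "(\<Union>(F, d) \<in> M1.flats \<times> UNIV. M2.cl_fibre_dim (\<alpha> F) d) = M2.subspaces_of E2"
  proof -
    have "(\<Union>(F, d) \<in> M1.flats \<times> UNIV. M2.cl_fibre_dim (\<alpha> F) d) = (\<Union>G \<in> \<alpha> ` M1.flats. M2.cl_fibre G)"
      by (auto simp: M2.cl_fibre_dim_def)
    also have "\<dots> = M2.subspaces_of E2"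
      using bij M2.cl_in_flats by (auto simp: bij_betw_def M2.cl_fibre_def)
    finally show ?thesis .
  qed
  ultimately have "bij_betw \<beta> (M1.subspaces_of E1) (M2.subspaces_of E2)"
    by simp
  moreover have "M2.dim (\<beta> V) = M1.dim V \<and> \<rho>2 (\<beta> V) = \<rho>1 V" if V: "V \<in> M1.subspaces_of E1" for V
  proof -
    have flat: "M1.cl V \<in> M1.flats" "\<alpha> (M1.cl V) \<in> M2.flats"
      using M1.cl_in_flats[OF V] bij by (auto simp: bij_betw_apply)
    have \<beta>V: "\<beta> V \<in> M2.subspaces_of E2" "M2.cl (\<beta> V) = \<alpha> (M1.cl V)" "M2.dim (\<beta> V) = M1.dim V"
      using \<beta>_fibre[OF flat(1) fibre[OF V]] by (auto simp: M2.cl_fibre_dim_def M2.cl_fibre_def)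
    \<comment> \<open>Both ranks are computed at the closures, which correspond under
      \<alpha>.\<close>
    have "\<rho>2 (\<beta> V) = \<rho>2 (\<alpha> (M1.cl V))"
      using M2.rank_cl[OF \<beta>V(1)] \<beta>V(2) by simp
    also have "\<dots> = \<rho>1 (M1.cl V)"
      using flat card_eq[OF flat(1)] by (rule rank_flat_eq)
    also have "\<dots> = \<rho>1 V"
      by (rule M1.rank_cl[OF V])
    finally show ?thesis
      using \<beta>V(3) by simp
  qed
  \<comment> \<open>The choice of \<open>b\<close> has no freedom here: the value lies in the fibre
    of \<open>\<alpha> F\<close> and has dimension \<open>dim F\<close>, which is that of
    \<open>\<alpha> F\<close>.\<close>
  moreover have "\<beta> F = \<alpha> F" if F: "F \<in> M1.flats" for F
    using \<beta>_fibre[OF F M1.flat_in_cl_fibre[OF F]] F dim bij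
    by (intro M2.cl_fibre_eq_flat) (auto simp: M2.cl_fibre_dim_def dim_preserving_def bij_betw_apply)
  moreover have "\<beta> ` M1.cl_fibre F = M2.cl_fibre (\<alpha> F)" if F: "F \<in> M1.flats" for F
  proof -
    have "\<beta> ` M1.cl_fibre F = (\<Union>d. \<beta> ` M1.cl_fibre_dim F d)"
      by (auto simp: M1.cl_fibre_dim_def)
    also have "\<dots> = (\<Union>d. M2.cl_fibre_dim (\<alpha> F) d)"
      using piece[OF F] by (simp add: bij_betw_def)
    also have "\<dots> = M2.cl_fibre (\<alpha> F)"
      by (auto simp: M2.cl_fibre_dim_def)
    finally show ?thesis .
  qed
  ultimately show ?thesis
    by (intro exI[of _ \<beta>]) blast
qed

end
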